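(* Let $(W,S)$ be a Coxeter group with finite generating set $S$. Two Coxeter elements of $(W,S)$ are conjugate in $W$ if and only if they are rotation equivalent.
   Context: A Coxeter word is a word in the alphabet $S$ in which every generator $s\in S$ occurs exactly once (a permutation of $S$). A Coxeter element is an element of $W$ represented by the product of the letters of a Coxeter word, in order. A rotation of a word is the operation of moving its first letter to the end of the word. A (legal) commutation is the operation of interchanging two adjacent distinct letters $s,t$ of a word for which $st=ts$ in $W$ (i.e. $s$ and $t$ are not joined by an edge in the Coxeter graph). Two Coxeter words are rotation equivalent if one can be obtained from the other by a finite sequence of rotations and commutations. Two Coxeter elements are rotation equivalent if Coxeter words representing them can be transformed into each other through a finite sequence of rotations and commutations. *)

theory Defs
  imports "HOL-Algebra.Algebra" "HOL-Library.Extended_Nat"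
begin

definition coxeter_matrix :: "'a set \<Rightarrow> ('a \<Rightarrow> 'a \<Rightarrow> enat) \<Rightarrow> bool" where
  "coxeter_matrix S m \<longleftrightarrow>
     (\<forall>s\<in>S. \<forall>t\<in>S. 1 \<le> m s t \<and> m s t = m t s \<and> (m s t = 1 \<longleftrightarrow> s = t))"

text \<open>
  The presentation with generators \<open>S\<close> and relations \<open>(s t)\<^sup>m = 1\<close>, where \<open>m = m s t\<close> is finite,
  as a congruence on words: two words present the same element iff they are joined by
  insertions and deletions of relators. Formal inverses of letters are not needed, because
  \<open>m s s = 1\<close> makes \<open>s s\<close> a relator, so every letter is its own inverse.
\<close>

inductive relator_deletion ::
    "'a set \<Rightarrow> ('a \<Rightarrow> 'a \<Rightarrow> enat) \<Rightarrow> 'a list \<Rightarrow> 'a list \<Rightarrow> bool"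
  for S :: "'a set" and m :: "'a \<Rightarrow> 'a \<Rightarrow> enat" where
  "\<lbrakk>u \<in> lists S; v \<in> lists S; s \<in> S; t \<in> S; m s t = enat k\<rbrakk>
     \<Longrightarrow> relator_deletion S m (u @ concat (replicate k [s, t]) @ v) (u @ v)"

definition presentation_equiv ::
    "'a set \<Rightarrow> ('a \<Rightarrow> 'a \<Rightarrow> enat) \<Rightarrow> 'a list \<Rightarrow> 'a list \<Rightarrow> bool" where
  "presentation_equiv S m = equivclp (relator_deletion S m)"

definition word_prod :: "('a, 'b) monoid_scheme \<Rightarrow> 'a list \<Rightarrow> 'a" where
  "word_prod W w = foldr (\<otimes>\<^bsub>W\<^esub>) w \<one>\<^bsub>W\<^esub>"

text \<open>
  \<open>presentation\<close> together with \<open>generates\<close> says that evaluation of words is an isomorphism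
  from the group presented by a Coxeter matrix onto \<open>W\<close>. Finiteness of \<open>S\<close> is not built in.
\<close>

locale coxeter_group = group W for W (structure) +
  fixes S :: "'a set"
  assumes generators: "S \<subseteq> carrier W"
    and generates: "generate W S = carrier W"
    and presentation: "\<exists>m. coxeter_matrix S m \<and>
      (\<forall>u\<in>lists S. \<forall>v\<in>lists S.
         word_prod W u = word_prod W v \<longleftrightarrow> presentation_equiv S m u v)"

definition coxeter_word :: "'a set \<Rightarrow> 'a list \<Rightarrow> bool" where
  "coxeter_word S w \<longleftrightarrow> distinct w \<and> set w = S"

definition coxeter_element :: "('a, 'b) monoid_scheme \<Rightarrow> 'a set \<Rightarrow> 'a \<Rightarrow> bool" where
  "coxeter_element W S c \<longleftrightarrow> (\<exists>w. coxeter_word S w \<and> word_prod W w = c)"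

inductive rotation_step :: "('a, 'b) monoid_scheme \<Rightarrow> 'a list \<Rightarrow> 'a list \<Rightarrow> bool"
  for W :: "('a, 'b) monoid_scheme" where
  rotation: "rotation_step W (s # w) (w @ [s])"
| commutation: "\<lbrakk>s \<noteq> t; s \<otimes>\<^bsub>W\<^esub> t = t \<otimes>\<^bsub>W\<^esub> s\<rbrakk>
     \<Longrightarrow> rotation_step W (u @ [s, t] @ v) (u @ [t, s] @ v)"

definition rotation_equiv_words :: "('a, 'b) monoid_scheme \<Rightarrow> 'a list \<Rightarrow> 'a list \<Rightarrow> bool" where
  "rotation_equiv_words W = (rotation_step W)\<^sup>*\<^sup>*"

definition rotation_equiv ::
    "('a, 'b) monoid_scheme \<Rightarrow> 'a set \<Rightarrow> 'a \<Rightarrow> 'a \<Rightarrow> bool" where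
  "rotation_equiv W S c c' \<longleftrightarrow>
     (\<exists>w w'. coxeter_word S w \<and> coxeter_word S w' \<and>
        word_prod W w = c \<and> word_prod W w' = c' \<and> rotation_equiv_words W w w')"

definition conjugate_in :: "('a, 'b) monoid_scheme \<Rightarrow> 'a \<Rightarrow> 'a \<Rightarrow> bool" where
  "conjugate_in W a b \<longleftrightarrow> (\<exists>g\<in>carrier W. b = g \<otimes>\<^bsub>W\<^esub> a \<otimes>\<^bsub>W\<^esub> inv\<^bsub>W\<^esub> g)"

end

theory Submission
  imports Defs "Jordan_Normal_Form.Determinant"
begin

text \<open>
  One direction is a computation: a rotation conjugates the product by a letter, and a
  commutation does not change it. For the converse, let \<open>m\<close> be the Coxeter matrix and join
  distinct letters \<open>s\<close> and \<open>t\<close> by an edge if \<open>m s t \<noteq> 2\<close>, so that letters without an edge commute.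
  A Coxeter word orients every edge of this graph from the earlier to the later letter, and
  the orientation determines the word up to commutations. The proof exhibits an
  invariant of conjugacy that determines the orientation up to rotation: for every cycle of
  the graph, the number of its edges that are traversed in the direction of the orientation.

  The invariant is read off from characteristic polynomials. For positive weights
  \<open>\<tau> s t\<close> with \<open>\<tau> s t * \<tau> t s = 1\<close> the formula \<open>s(v) = v - (\<Sum>t. a s t * v t) e\<^sub>s\<close> with
  \<open>a s s = 2\<close> and \<open>a s t = - 2 cos (\<pi> / m s t) * \<tau> s t\<close> defines a representation of \<open>W\<close>, because the
  dihedral relations only constrain the products \<open>a s t * a t s\<close>, which \<open>\<tau>\<close> does not change
  (\<open>dihedral_relation\<close>, \<open>act_presentation_equiv\<close>). Split \<open>a\<close> as \<open>U + L\<close>, where the unitriangular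
  matrix \<open>U\<close> holds the entries \<open>a s t\<close> with \<open>s\<close> ahead of \<open>t\<close> in a Coxeter word \<open>w\<close>. The element
  represented by \<open>w\<close> then acts as \<open>- U\<^sup>-\<^sup>1 L\<close>, so its characteristic polynomial at \<open>x\<close>
  is \<open>det (x U + L)\<close> (\<open>char_poly_coxeter_word\<close>). Each edge of a cycle contributes a factor \<open>x\<close>
  exactly if it is traversed along the orientation. Weights tending to infinity along
  the arcs of one cycle let the terms containing this cycle dominate, and as \<open>x\<close> tends to \<open>0\<close> the
  leading power of \<open>x\<close> reveals the number of forward edges
  (\<open>char_poly_asymptotics\<close>, \<open>ahead_sum_eq_if_conjugate\<close>).

  If two orientations have the same number of forward edges on every cycle, their difference
  is an integer cochain that vanishes on cycles, hence a difference \<open>h x - h y\<close> of a potential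
  (\<open>closed_walk_sum_zero\<close>, \<open>potential_if_closed_walks_zero\<close>). Such a potential can be lowered to
  zero by rotations: among the letters of maximal potential, the first one in the word can be
  commuted to the front, and rotating it lowers its potential by one
  (\<open>rotation_equiv_if_coboundary\<close>).
\<close>

section \<open>Orientations defined by words, and firing letters\<close>

definition pos :: "'a list \<Rightarrow> 'a \<Rightarrow> nat" where
  "pos w x = length (takeWhile (\<lambda>y. y \<noteq> x) w)"

lemma pos_Cons: "pos (y # ys) x = (if x = y then 0 else Suc (pos ys x))"
  by (auto simp: pos_def)

lemma pos_append:
  "pos (xs @ ys) x = (if x \<in> set xs then pos xs x else length xs + pos ys x)"
  by (induction xs) (auto simp: pos_Cons pos_def)

lemma pos_less_length: "pos w x < length w \<longleftrightarrow> x \<in> set w"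
  by (induction w) (auto simp: pos_Cons pos_def)

lemma nth_pos: "x \<in> set w \<Longrightarrow> w ! pos w x = x"
  by (induction w) (auto simp: pos_Cons)

lemma pos_nth: "distinct w \<Longrightarrow> k < length w \<Longrightarrow> pos w (w ! k) = k"
  by (metis nth_eq_iff_index_eq nth_mem nth_pos pos_less_length)

lemma pos_eq_iff: "x \<in> set w \<Longrightarrow> y \<in> set w \<Longrightarrow> pos w x = pos w y \<longleftrightarrow> x = y"
  by (metis nth_pos)

text \<open>
  The orientation of the edge between \<open>x\<close> and \<open>y\<close>, as an integer so that orientations can be
  subtracted.
\<close>

definition ahead :: "'a list \<Rightarrow> 'a \<Rightarrow> 'a \<Rightarrow> int" where
  "ahead w x y = of_bool (pos w x < pos w y)"

lemma ahead_swap: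
  "x \<in> set w \<Longrightarrow> y \<in> set w \<Longrightarrow> x \<noteq> y \<Longrightarrow> ahead w y x = 1 - ahead w x y"
  using pos_eq_iff[of x w y] by (auto simp: ahead_def of_bool_def)

text \<open>
  Commutations are separated from rotations because they, unlike rotations, may be carried out
  inside a longer word; this is what the inductions on words rest on.
\<close>

inductive commutation_step :: "('a \<Rightarrow> 'a \<Rightarrow> bool) \<Rightarrow> 'a list \<Rightarrow> 'a list \<Rightarrow> bool"
  for R where
  "\<lbrakk>s \<noteq> t; R s t\<rbrakk> \<Longrightarrow> commutation_step R (u @ [s, t] @ v) (u @ [t, s] @ v)"

lemma commutation_steps_Cons:
  assumes "(commutation_step R)\<^sup>*\<^sup>* xs ys"
  shows "(commutation_step R)\<^sup>*\<^sup>* (z # xs) (z # ys)"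
  using assms
proof (induction rule: rtranclp_induct)
  case (step ys zs)
  from step.hyps(2) have "commutation_step R (z # ys) (z # zs)"
    by cases (metis append_Cons commutation_step.intros)
  with step.IH show ?case by (rule rtranclp.rtrancl_into_rtrancl)
qed simp

lemma commute_to_front:
  assumes "\<And>j. j \<in> set u \<Longrightarrow> j \<noteq> i \<and> R j i"
  shows "(commutation_step R)\<^sup>*\<^sup>* (u @ i # v) (i # u @ v)"
  using assms
proof (induction u)
  case (Cons a u)
  then have "(commutation_step R)\<^sup>*\<^sup>* (a # u @ i # v) (a # i # u @ v)"
    by (intro commutation_steps_Cons) auto
  moreover have "commutation_step R ([] @ [a, i] @ (u @ v)) ([] @ [i, a] @ (u @ v))"
    using Cons.prems by (intro commutation_step.intros) auto
  ultimately show ?case by simp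
qed simp

text \<open>
  A word is determined up to commutations by the relative order of its non-commuting letters:
  every letter that stands before the first letter of \<open>w'\<close> in \<open>w\<close> has changed sides with it
  and therefore commutes with it, so this letter can be brought to the front of \<open>w\<close>.
\<close>

lemma commutation_equiv_if_same_order:
  assumes "distinct w" "distinct w'" "set w = set w'"
    and "\<And>x y. \<lbrakk>x \<in> set w; y \<in> set w; x \<noteq> y; \<not> R x y\<rbrakk> \<Longrightarrow> ahead w x y = ahead w' x y"
  shows "(commutation_step R)\<^sup>*\<^sup>* w w'"
  using assms
proof (induction w' arbitrary: w)
  case (Cons i r)
  then obtain u v where w: "w = u @ i # v"
    by (metis list.set_intros(1) split_list)
  have "j \<noteq> i \<and> R j i" if "j \<in> set u" for j
  proof (rule ccontr)
    assume *: "\<not> ?thesis"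
    have "j \<noteq> i" using that Cons.prems(1) w by auto
    moreover have "pos w j < pos w i"
      using that Cons.prems(1) w pos_less_length[of u j] by (auto simp: pos_append pos_Cons)
    ultimately show False
      using Cons.prems(4)[of j i] * that w by (auto simp: ahead_def pos_Cons)
  qed
  then have "(commutation_step R)\<^sup>*\<^sup>* w (i # u @ v)"
    unfolding w by (rule commute_to_front)
  moreover have "(commutation_step R)\<^sup>*\<^sup>* (u @ v) r"
  proof (rule Cons.IH)
    have "set (u @ v) = set w - {i}" using Cons.prems(1) w by auto
    also have "\<dots> = set r" using Cons.prems(2,3) by auto
    finally show "set (u @ v) = set r" .
    fix x y assume xy: "x \<in> set (u @ v)" "y \<in> set (u @ v)" "x \<noteq> y" "\<not> R x y"
    have "i \<noteq> x" "i \<noteq> y" using xy Cons.prems(1) w by auto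
    then have "ahead (u @ v) x y = ahead w x y" "ahead (i # r) x y = ahead r x y"
      using xy pos_less_length[of u x] pos_less_length[of u y]
      by (auto simp: w ahead_def pos_append pos_Cons)
    with Cons.prems(4)[of x y] xy w show "ahead (u @ v) x y = ahead r x y" by auto
  qed (use Cons.prems w in auto)
  then have "(commutation_step R)\<^sup>*\<^sup>* (i # u @ v) (i # r)"
    by (rule commutation_steps_Cons)
  ultimately show ?case by simp
qed simp

lemma rotation_steps_if_commutation_steps:
  assumes "(commutation_step (\<lambda>s t. s \<otimes>\<^bsub>W\<^esub> t = t \<otimes>\<^bsub>W\<^esub> s))\<^sup>*\<^sup>* w w'"
  shows "(rotation_step W)\<^sup>*\<^sup>* w w'"
  using assms
proof (rule rtranclp_mono[THEN predicate2D, rotated])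
  show "commutation_step (\<lambda>s t. s \<otimes>\<^bsub>W\<^esub> t = t \<otimes>\<^bsub>W\<^esub> s) \<le> rotation_step W"
    by (auto elim!: commutation_step.cases intro: rotation_step.commutation[simplified])
qed

text \<open>
  Induction on the total potential. If it is zero, the orientations agree. Otherwise let \<open>i\<close> be
  the first letter of \<open>w\<close> with maximal potential. A letter \<open>j\<close> before \<open>i\<close> has smaller potential;
  if it did not commute with \<open>i\<close>, the equation for \<open>j\<close> and \<open>i\<close> would equate the nonnegative
  number \<open>1 - ahead w' j i\<close> with a negative one. Hence \<open>i\<close> can be commuted to the front, and
  rotating it to the end turns all its edges from outgoing to incoming, which is what lowering
  \<open>h i\<close> by one accounts for.
\<close>

lemma rotation_equiv_if_coboundary:
  fixes h :: "'a \<Rightarrow> nat"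
  assumes "distinct w" "distinct w'" "set w = set w'"
    and "\<And>x y. \<lbrakk>x \<in> set w; y \<in> set w; x \<noteq> y; x \<otimes>\<^bsub>W\<^esub> y \<noteq> y \<otimes>\<^bsub>W\<^esub> x\<rbrakk>
           \<Longrightarrow> ahead w x y - ahead w' x y = int (h x) - int (h y)"
  shows "rotation_equiv_words W w w'"
  using assms
proof (induction "\<Sum>x\<in>set w'. h x" arbitrary: w h rule: less_induct)
  case less
  define R where "R = (\<lambda>s t. s \<otimes>\<^bsub>W\<^esub> t = t \<otimes>\<^bsub>W\<^esub> s)"
  show ?case
  proof (cases "\<forall>x\<in>set w. h x = 0")
    case True
    then have "(commutation_step R)\<^sup>*\<^sup>* w w'"
      using less.prems by (intro commutation_equiv_if_same_order) (auto simp: R_def)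
    then show ?thesis
      unfolding rotation_equiv_words_def R_def by (rule rotation_steps_if_commutation_steps)
  next
    case False
    define M where "M = Max (h ` set w)"
    have le_M: "h x \<le> M" if "x \<in> set w" for x using that by (simp add: M_def)
    have "M \<in> h ` set w" unfolding M_def using False by (intro Max_in) auto
    then have "\<exists>x\<in>set w. h x = M" by auto
    then obtain u i v where w: "w = u @ i # v" and i: "h i = M" and u: "\<And>j. j \<in> set u \<Longrightarrow> h j \<noteq> M"
      by (auto dest!: split_list_first_prop)
    have "M > 0" using False le_M by fastforce
    have "j \<noteq> i \<and> R j i" if j: "j \<in> set u" for j
    proof (rule ccontr)
      assume *: "\<not> ?thesis"
      have "j \<noteq> i" using less.prems(1) w j by auto
      moreover have "pos w j < pos w i"
        using j less.prems(1) w pos_less_length[of u j] by (auto simp: pos_append pos_Cons)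
      then have "ahead w j i = 1" by (simp add: ahead_def)
      moreover have "h j < M" using u[OF j] le_M[of j] j w by auto
      ultimately show False
        using less.prems(4)[of j i] * j w i by (auto simp: R_def ahead_def of_bool_def split: if_splits)
    qed
    then have "(commutation_step R)\<^sup>*\<^sup>* w (i # u @ v)"
      unfolding w by (rule commute_to_front)
    then have "(rotation_step W)\<^sup>*\<^sup>* w (i # u @ v)"
      unfolding R_def by (rule rotation_steps_if_commutation_steps)
    moreover have "rotation_step W (i # u @ v) ((u @ v) @ [i])"
      by (rule rotation_step.rotation)
    ultimately have step: "(rotation_step W)\<^sup>*\<^sup>* w ((u @ v) @ [i])" by simp
    define w1 where "w1 = (u @ v) @ [i]"
    have w1: "distinct w1" "set w1 = set w" using less.prems(1) w by (auto simp: w1_def)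
    have last: "ahead w1 j i = 1" if "j \<in> set w" "j \<noteq> i" for j
      using that w pos_less_length[of "u @ v" j] w1(1)
      by (auto simp: w1_def ahead_def pos_append pos_Cons)
    have first: "ahead w j i = 0 \<or> R j i" if "j \<in> set w" "j \<noteq> i" for j
      using that less.prems(1) w pos_less_length[of u j]
        \<open>\<And>j. j \<in> set u \<Longrightarrow> j \<noteq> i \<and> R j i\<close>
      by (auto simp: ahead_def pos_append pos_Cons)
    have others: "ahead w1 x y = ahead w x y" if "x \<in> set w" "y \<in> set w" "x \<noteq> i" "y \<noteq> i" for x y
      using that w pos_less_length[of u x] pos_less_length[of u y]
      by (auto simp: w1_def ahead_def pos_append pos_Cons)
    define h1 where "h1 = h(i := M - 1)"
    have "rotation_equiv_words W w1 w'"
    proof (rule less.hyps)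
      have "i \<in> set w'" using less.prems(3) w by auto
      then show "sum h1 (set w') < sum h (set w')"
        using \<open>M > 0\<close> i by (intro sum_strict_mono_ex1) (auto simp: h1_def intro!: bexI[of _ i])
      show "set w1 = set w'" using w1 less.prems(3) by simp
      fix x y assume xy: "x \<in> set w1" "y \<in> set w1" "x \<noteq> y" "x \<otimes>\<^bsub>W\<^esub> y \<noteq> y \<otimes>\<^bsub>W\<^esub> x"
      have iw: "i \<in> set w" "i \<in> set w1" using w w1 by auto
      have eq: "ahead w x y - ahead w' x y = int (h x) - int (h y)"
        using less.prems(4) xy w1 by blast
      consider "x = i" | "y = i" | "x \<noteq> i" "y \<noteq> i" by blast
      then show "ahead w1 x y - ahead w' x y = int (h1 x) - int (h1 y)"
      proof cases
        case 1
        then have "ahead w y i = 0" using first[of y] xy w1 by (auto simp: R_def)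
        with 1 xy w1 iw eq i \<open>M > 0\<close> last[of y] ahead_swap[of y w i] ahead_swap[of y w1 i]
        show ?thesis by (auto simp: h1_def)
      next
        case 2
        then have "ahead w x i = 0" using first[of x] xy w1 by (auto simp: R_def)
        with 2 xy w1 iw eq i \<open>M > 0\<close> last[of x]
        show ?thesis by (auto simp: h1_def)
      next
        case 3
        with others[of x y] xy w1 eq show ?thesis by (simp add: h1_def)
      qed
    qed (use w1 less.prems in auto)
    with step show ?thesis unfolding rotation_equiv_words_def w1_def by simp
  qed
qed

section \<open>Cochains that vanish on cycles are coboundaries\<close>

fun walk_sum :: "('a \<Rightarrow> 'a \<Rightarrow> int) \<Rightarrow> 'a list \<Rightarrow> int" where
  "walk_sum d (x # y # zs) = d x y + walk_sum d (y # zs)"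
| "walk_sum d _ = 0"

lemma walk_sum_append:
  "walk_sum d (xs @ y # ys) = walk_sum d (xs @ [y]) + walk_sum d (y # ys)"
proof (induction xs)
  case (Cons a xs) then show ?case by (cases xs) auto
qed simp

lemma walk_sum_rev:
  assumes "\<And>x y. E x y \<Longrightarrow> d x y + d y x = 0" and "successively E xs"
  shows "walk_sum d (rev xs) = - walk_sum d xs"
  using assms(2)
proof (induction xs rule: induct_list012)
  case (3 x y zs)
  have "walk_sum d (rev (x # y # zs)) = walk_sum d (rev (y # zs)) + d y x"
    using walk_sum_append[of d "rev zs" y "[x]"] by simp
  with 3 assms(1)[of x y] show ?case by simp
qed auto

lemma walk_sum_zip:
  "walk_sum d (x # ys) = (\<Sum>k<length ys. d ((x # ys) ! k) (ys ! k))"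
proof (induction ys arbitrary: x)
  case (Cons y ys) 
  then show ?case by (simp add: sum.lessThan_Suc_shift del: sum.lessThan_Suc)
qed simp

text \<open>
  A closed walk that visits a vertex twice splits there into two shorter closed walks, so only
  walks without repetition remain. Those of length two go back and forth along one edge, and the
  others are cycles. A cycle is presented as a permutation \<open>\<sigma>\<close> of its vertex set \<open>C\<close>; the
  condition \<open>\<sigma> (\<sigma> i) \<noteq> i\<close> says that no edge is traversed in both directions.
\<close>

lemma closed_walk_sum_zero:
  assumes irrefl: "\<And>x. \<not> E x x"
    and anti: "\<And>x y. E x y \<Longrightarrow> d x y + d y x = 0"
    and perm: "\<And>C \<sigma>. \<lbrakk>finite C; bij_betw \<sigma> C C; \<And>i. i \<in> C \<Longrightarrow> E i (\<sigma> i) \<and> \<sigma> (\<sigma> i) \<noteq> i\<rbrakk>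
        \<Longrightarrow> (\<Sum>i\<in>C. d i (\<sigma> i)) = 0"
    and "successively E xs" "xs \<noteq> []" "hd xs = last xs"
  shows "walk_sum d xs = 0"
  using assms(4-6)
proof (induction xs rule: length_induct)
  case (1 xs)
  then obtain x ys where xs: "xs = x # ys" by (cases xs) auto
  show ?case
  proof (cases "distinct ys")
    case False
    then obtain as y bs cs where ys: "ys = as @ [y] @ bs @ [y] @ cs"
      using not_distinct_decomp by blast
    have "successively E ((y # bs) @ [y])"
      using 1(2) by (auto simp: xs ys successively_append_iff successively_Cons hd_append
          split: if_splits)
    then have "walk_sum d (y # bs @ [y]) = 0"
      using 1(1) by (auto simp: xs ys)
    moreover have "successively E (x # as @ y # cs)"
      using 1(2) by (auto simp: xs ys successively_append_iff successively_Cons hd_append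
          split: if_splits)
    then have "walk_sum d (x # as @ y # cs) = 0"
      using 1 by (auto simp: xs ys)
    moreover have "walk_sum d xs = walk_sum d ((x # as) @ [y]) + walk_sum d ((y # bs) @ y # cs)"
      using walk_sum_append[of d "x # as" y "bs @ y # cs"] by (simp add: xs ys)
    ultimately show ?thesis
      using walk_sum_append[of d "x # as" y "cs"] walk_sum_append[of d "y # bs" y "cs"] by simp
  next
    case True
    consider "ys = []" | y where "ys = [y]" | y z where "ys = [y, z]" | "length ys \<ge> 3"
      by (cases ys; cases "tl ys"; cases "tl (tl ys)") auto
    then show ?thesis
    proof cases
      case 4
      define n where "n = length ys"
      have n: "n \<ge> 3" using 4 n_def by simp
      have lst: "ys ! (n - 1) = x"
        using 1(4) n by (auto simp: xs n_def last_conv_nth split: if_splits)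
      \<comment> \<open>The vertices of \<open>ys\<close> form the cycle; its last entry is \<open>x\<close>, which leads back to the first.\<close>
      define \<sigma> where "\<sigma> v = ys ! ((pos ys v + 1) mod n)" for v
      have \<sigma>: "\<sigma> (ys ! k) = ys ! ((k + 1) mod n)" if "k < n" for k
        using that True by (simp add: \<sigma>_def pos_nth n_def)
      have set: "set ys = (\<lambda>k. ys ! k) ` {..<n}"
        by (auto simp: n_def set_conv_nth)
      have inj: "inj_on (\<lambda>k. ys ! k) {..<n}"
        using True by (auto simp: n_def inj_on_def nth_eq_iff_index_eq)
      have E: "E (ys ! k) (\<sigma> (ys ! k))" if "k < n" for k
      proof (cases "k + 1 < n")
        case True
        then show ?thesis using \<sigma>[OF that] 1(2) xs
          by (auto simp: n_def successively_Cons successively_conv_nth)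
      next
        case False
        then have "k = n - 1" using that by simp
        moreover have "E x (ys ! 0)" using 1(2) n xs
          by (cases ys) (auto simp: n_def successively_Cons)
        ultimately show ?thesis using \<sigma>[OF that] lst n by simp
      qed
      have sub: "\<sigma> ` set ys \<subseteq> set ys"
        using n by (auto simp: set \<sigma>)
      have injs: "inj_on \<sigma> (set ys)"
      proof (rule inj_onI)
        fix a b assume "a \<in> set ys" "b \<in> set ys" and eq: "\<sigma> a = \<sigma> b"
        then obtain k l where kl: "k < n" "l < n" "a = ys ! k" "b = ys ! l" by (auto simp: set)
        with eq \<sigma> have "ys ! ((k + 1) mod n) = ys ! ((l + 1) mod n)" by simp
        then have "(k + 1) mod n = (l + 1) mod n"
          using inj kl by (auto simp: inj_on_def)
        then have "k = l" using kl
          by (cases "k + 1 = n"; cases "l + 1 = n") auto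
        with kl show "a = b" by simp
      qed
      have "bij_betw \<sigma> (set ys) (set ys)"
        using endo_inj_surj[OF _ sub injs] injs by (simp add: bij_betw_def)
      moreover have "E i (\<sigma> i) \<and> \<sigma> (\<sigma> i) \<noteq> i" if "i \<in> set ys" for i
      proof -
        obtain k where k: "k < n" "i = ys ! k" using \<open>i \<in> set ys\<close> by (auto simp: set)
        have "\<sigma> (\<sigma> i) = ys ! (((k + 1) mod n + 1) mod n)" using k n by (simp add: \<sigma>)
        moreover have "((k + 1) mod n + 1) mod n \<noteq> k"
          using k n by (cases "k + 1 = n"; cases "k + 2 = n") (auto simp: mod_simps)
        ultimately show ?thesis using k n inj E by (auto simp: inj_on_def)
      qed
      ultimately have "(\<Sum>i\<in>set ys. d i (\<sigma> i)) = 0" by (intro perm) auto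
      also have "(\<Sum>i\<in>set ys. d i (\<sigma> i)) = (\<Sum>k<n. d (ys ! k) (ys ! ((k + 1) mod n)))"
        unfolding set using inj \<sigma> by (subst sum.reindex) auto
      also have "\<dots> = (\<Sum>k<n - 1. d (ys ! k) (ys ! (k + 1))) + d x (ys ! 0)"
      proof -
        obtain n' where n': "n = Suc n'" using n by (cases n) auto
        then show ?thesis using lst by simp
      qed
      also have "\<dots> = walk_sum d xs"
      proof -
        obtain n' where n': "n = Suc n'" using n by (cases n) auto
        then show ?thesis unfolding xs walk_sum_zip n_def[symmetric]
          by (simp add: sum.lessThan_Suc_shift del: sum.lessThan_Suc)
      qed
      finally show ?thesis by simp
    qed (use 1 irrefl anti xs in auto)
  qed
qed

text \<open>
  The potential of a vertex is the sum along any walk to it from a fixed root of its connected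
  component; the choice of the walk does not matter because two of them form a closed walk.
  The sign is reversed to fit \<open>h x - h y\<close>.
\<close>

lemma potential_if_closed_walks_zero:
  assumes sym: "\<And>x y. E x y \<Longrightarrow> E y x" 
    and anti: "\<And>x y. E x y \<Longrightarrow> d x y + d y x = 0"
    and closed: "\<And>xs. \<lbrakk>successively E xs; xs \<noteq> []; hd xs = last xs\<rbrakk> \<Longrightarrow> walk_sum d xs = 0"
  obtains h :: "'a \<Rightarrow> int" where "\<And>x y. E x y \<Longrightarrow> d x y = h x - h y"
proof -
  define walk where "walk r x xs \<longleftrightarrow> successively E xs \<and> xs \<noteq> [] \<and> hd xs = r \<and> last xs = x" for r x xs
  define root where "root x = (SOME r. \<exists>xs. walk r x xs)" for x
  define path where "path x = (SOME xs. walk (root x) x xs)" for x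
  have ex: "\<exists>xs. walk (root x) x xs" for x
    unfolding root_def by (rule someI[of _ x]) (auto simp: walk_def intro!: exI[of _ "[x]"])
  have path: "walk (root x) x (path x)" for x
    unfolding path_def using ex by (rule someI_ex)
  have extend: "\<exists>xs. walk r y xs" if "walk r x xs" "E x y" for r x y xs
    using that by (auto simp: walk_def successively_append_iff intro!: exI[of _ "xs @ [y]"])
  have root: "root x = root y" if "E x y" for x y
  proof -
    have "(\<exists>xs. walk r x xs) \<longleftrightarrow> (\<exists>xs. walk r y xs)" for r
      using extend that sym by metis
    then show ?thesis by (simp add: root_def)
  qed
  have "walk_sum d (path x) + d x y - walk_sum d (path y) = 0" if "E x y" for x y
  proof -
    obtain p where p: "path x = p @ [x]" using path[of x] 
      by (metis append_butlast_last_id walk_def)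
    obtain q where q: "path y = q @ [y]" using path[of y]
      by (metis append_butlast_last_id walk_def)
    have sy: "successively E (path x)" "successively E (path y)" 
      using path by (auto simp: walk_def)
    have "successively (\<lambda>x y. E y x) (path y)"
      using sy(2) by (rule successively_mono) (use sym in auto)
    then have "successively E (path x @ rev (path y))"
      using sy that by (auto simp: p q successively_append_iff successively_Cons hd_rev)
    moreover have "hd (path x @ rev (path y)) = last (path x @ rev (path y))"
      using path[of x] path[of y] root[OF that] by (auto simp: walk_def last_rev)
    ultimately have "walk_sum d (path x @ rev (path y)) = 0"
      using p by (intro closed) auto
    moreover have "walk_sum d (path x @ rev (path y)) = walk_sum d (path x) + (d x y + walk_sum d (rev (path y)))"
      using walk_sum_append[of d p x "y # rev q"] by (simp add: p q)
    ultimately show ?thesis using walk_sum_rev[OF anti sy(2)] by simp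
  qed
  then show ?thesis by (intro that[of "\<lambda>x. - walk_sum d (path x)"]) fastforce
qed

section \<open>Reflection representations\<close>

definition pairing :: "'a set \<Rightarrow> ('a \<Rightarrow> 'a \<Rightarrow> real) \<Rightarrow> 'a \<Rightarrow> ('a \<Rightarrow> real) \<Rightarrow> real" where
  "pairing S a s v = (\<Sum>j\<in>S. a s j * v j)"

definition reflection ::
    "'a set \<Rightarrow> ('a \<Rightarrow> 'a \<Rightarrow> real) \<Rightarrow> 'a \<Rightarrow> ('a \<Rightarrow> real) \<Rightarrow> 'a \<Rightarrow> real" where
  "reflection S a s v = v(s := v s - pairing S a s v)"

text \<open>
  Vectors are functions on all of \<open>'a\<close>, but only coordinates in \<open>S\<close> enter the pairing or are
  moved, so this is the representation on the space with basis \<open>S\<close>.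
\<close>

definition act ::
    "'a set \<Rightarrow> ('a \<Rightarrow> 'a \<Rightarrow> real) \<Rightarrow> 'a list \<Rightarrow> ('a \<Rightarrow> real) \<Rightarrow> 'a \<Rightarrow> real" where
  "act S a w = foldr (reflection S a) w"

lemma act_simps [simp]:
  "act S a [] v = v"
  "act S a (s # w) v = reflection S a s (act S a w v)"
  "act S a (u @ w) v = act S a u (act S a w v)"
  by (simp_all add: act_def)

lemma pairing_shift:
  assumes "finite S" "s \<in> S" "t \<in> S"
  shows "pairing S a r (\<lambda>j. v j + \<alpha> * of_bool (j = s) + \<beta> * of_bool (j = t))
    = pairing S a r v + \<alpha> * a r s + \<beta> * a r t"
proof -
  have "pairing S a r (\<lambda>j. v j + \<alpha> * of_bool (j = s) + \<beta> * of_bool (j = t))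
    = pairing S a r v + (\<Sum>j\<in>S. if j = s then \<alpha> * a r s else 0) + (\<Sum>j\<in>S. if j = t then \<beta> * a r t else 0)"
    unfolding pairing_def sum.distrib[symmetric]
    by (intro sum.cong) (auto simp: algebra_simps)
  with assms show ?thesis by simp
qed

lemma reflection_involution:
  assumes "finite S" "s \<in> S" "a s s = 2"
  shows "reflection S a s (reflection S a s v) = v"
proof -
  have r: "reflection S a s v = (\<lambda>j. v j + (- pairing S a s v) * of_bool (j = s) + 0 * of_bool (j = s))"
    by (auto simp: reflection_def)
  have "pairing S a s (reflection S a s v) = - pairing S a s v"
    unfolding r pairing_shift[OF assms(1,2,2)] using assms(3) by simp
  then show ?thesis by (auto simp: reflection_def)
qed

text \<open>
  The iterates of the product of two reflections move a vector only within the plane of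
  \<open>e\<^sub>s\<close> and \<open>e\<^sub>t\<close>, by the amounts \<open>\<alpha>\<close> and \<open>\<beta>\<close> below. These have a closed form in the Chebyshev
  values \<open>u n = sin (n \<theta>) / sin \<theta>\<close>, of which \<open>u k\<close> is a common factor after \<open>k\<close> steps, and
  \<open>u k = 0\<close> for \<open>\<theta> = \<pi> / k\<close>. The factor \<open>\<tau>\<close> amounts to rescaling the basis vector \<open>e\<^sub>t\<close>. The case
  \<open>k = 2\<close>, where both off-diagonal entries vanish, is included.
\<close>

lemma dihedral_relation:
  fixes k :: nat
  assumes S: "finite S" "s \<in> S" "t \<in> S" "s \<noteq> t" and diag: "a s s = 2" "a t t = 2"
    and k: "k \<ge> 2" and \<tau>: "\<tau> \<noteq> 0"
    and st: "a s t = - 2 * cos (pi / k) * \<tau>" and ts: "a t s = - 2 * cos (pi / k) / \<tau>"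
  shows "((reflection S a s \<circ> reflection S a t) ^^ k) v = v"
proof -
  define \<theta> where "\<theta> = pi / k"
  define c where "c = 2 * cos \<theta>"
  define u where "u n = sin (n * \<theta>) / sin \<theta>" for n :: real
  define P where "P = pairing S a s v / \<tau>"
  define q where "q = pairing S a t v"
  have "\<theta> > 0" "\<theta> < pi"
    using k by (auto simp: \<theta>_def field_simps)
  then have sin: "sin \<theta> > 0" by (rule sin_gt_zero)
  have rec: "u (n + 1) = c * u n - u (n - 1)" for n
  proof -
    have "sin ((n + 1) * \<theta>) + sin ((n - 1) * \<theta>) = c * sin (n * \<theta>)"
      by (simp add: c_def distrib_right left_diff_distrib sin_add sin_diff)
    then show ?thesis
      unfolding u_def by (metis add_diff_cancel_right' add_divide_distrib times_divide_eq_right)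
  qed
  have quad: "u (n + 1) ^ 2 + u n ^ 2 - c * u n * u (n + 1) = 1" for n
  proof -
    define A B where "A = sin (n * \<theta>)" and "B = cos (n * \<theta>)"
    have A': "sin ((n + 1) * \<theta>) = A * cos \<theta> + B * sin \<theta>"
      by (simp add: distrib_right sin_add A_def B_def)
    have "(A * cos \<theta> + B * sin \<theta>) ^ 2 + A ^ 2 - c * A * (A * cos \<theta> + B * sin \<theta>)
        = A ^ 2 * (1 - cos \<theta> ^ 2) + B ^ 2 * sin \<theta> ^ 2"
      by (simp add: c_def power2_eq_square algebra_simps)
    also have "\<dots> = (A ^ 2 + B ^ 2) * sin \<theta> ^ 2"
      by (simp add: sin_squared_eq algebra_simps)
    also have "A ^ 2 + B ^ 2 = 1" by (simp add: A_def B_def)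
    finally have "(sin ((n + 1) * \<theta>) ^ 2 + A ^ 2 - c * A * sin ((n + 1) * \<theta>)) / sin \<theta> ^ 2 = 1"
      using sin by (simp add: A')
    then show ?thesis
      by (simp add: u_def A_def power_divide diff_divide_distrib add_divide_distrib power2_eq_square)
  qed
  define \<alpha> where "\<alpha> n = - u n * \<tau> * (u n * P + u (n + 1) * q)" for n
  define \<beta> where "\<beta> n = - u n * (u (n - 1) * P + u n * q)" for n
  have iter: "((reflection S a s \<circ> reflection S a t) ^^ n) v
      = (\<lambda>j. v j + \<alpha> n * of_bool (j = s) + \<beta> n * of_bool (j = t))" for n :: nat
  proof (induction n)
    case 0
    then show ?case by (auto simp: \<alpha>_def \<beta>_def u_def)
  next
    case (Suc n)
    define x where "x = (\<lambda>j. v j + \<alpha> n * of_bool (j = s) + \<beta> n * of_bool (j = t))"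
    define y where "y = (\<lambda>j. v j + \<alpha> n * of_bool (j = s) + \<beta> (real n + 1) * of_bool (j = t))"
    have b: "a t s * \<alpha> n = c * u n * (u n * P + u (real n + 1) * q)"
      using \<tau> by (simp add: ts \<alpha>_def c_def \<theta>_def add.commute)
    have "\<beta> (real n + 1) = - q - a t s * \<alpha> n - \<beta> n"
    proof -
      have "\<beta> (real n + 1) - (- q - a t s * \<alpha> n - \<beta> n)
          = q * (1 - (u (real n + 1) ^ 2 + u n ^ 2 - c * u n * u (real n + 1)))
            + P * u n * (c * u n - u (real n - 1) - u (real n + 1))"
        unfolding b by (simp add: \<beta>_def power2_eq_square algebra_simps)
      then show ?thesis unfolding quad unfolding rec[of "real n"] by simp
    qed
    moreover have "pairing S a t x = q + \<alpha> n * a t s + \<beta> n * 2"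
      unfolding x_def pairing_shift[OF S(1-3)] by (simp add: q_def diag)
    ultimately have y: "reflection S a t x = y"
      using S(4) by (auto simp: reflection_def x_def y_def)
    have "\<alpha> (real n + 1) = - P * \<tau> - \<alpha> n + c * \<tau> * \<beta> (real n + 1)"
    proof -
      have "\<alpha> (real n + 1) - (- P * \<tau> - \<alpha> n + c * \<tau> * \<beta> (real n + 1))
          = P * \<tau> * (1 - (u (real n + 1) ^ 2 + u n ^ 2 - c * u n * u (real n + 1)))
            + q * \<tau> * u (real n + 1) * (c * u (real n + 1) - u n - u (real n + 1 + 1))"
        by (simp add: \<alpha>_def \<beta>_def power2_eq_square algebra_simps)
      then show ?thesis unfolding quad using rec[of "real n + 1"] by simp
    qed
    moreover have "pairing S a s y = P * \<tau> + \<alpha> n * 2 - c * \<tau> * \<beta> (real n + 1)"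
      unfolding y_def pairing_shift[OF S(1-3)] using \<tau>
      by (simp add: P_def diag st c_def \<theta>_def)
    ultimately have "reflection S a s y
        = (\<lambda>j. v j + \<alpha> (real n + 1) * of_bool (j = s) + \<beta> (real n + 1) * of_bool (j = t))"
      using S(4) by (auto simp: reflection_def y_def)
    with Suc.IH y show ?case by (simp add: x_def add.commute)
  qed
  have "u k = 0" using k by (simp add: u_def \<theta>_def)
  then show ?thesis unfolding iter by (simp add: \<alpha>_def \<beta>_def)
qed

lemma act_relator:
  "act S a (concat (replicate k [s, t])) v = ((reflection S a s \<circ> reflection S a t) ^^ k) v"
  by (induction k) auto

text \<open>
  For \<open>\<infinity>\<close> there is no relation to satisfy; \<open>2\<close> is the limit of the finite values and makes
  the weight positive.
\<close>

definition coxeter_weight :: "enat \<Rightarrow> real" where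
  "coxeter_weight k = (case k of enat n \<Rightarrow> 2 * cos (pi / n) | \<infinity> \<Rightarrow> 2)"

lemma coxeter_weight_pos: "k \<ge> 1 \<Longrightarrow> k \<noteq> 1 \<Longrightarrow> k \<noteq> 2 \<Longrightarrow> coxeter_weight k > 0"
proof (cases k)
  case (enat n)
  assume "k \<ge> 1" "k \<noteq> 1" "k \<noteq> 2"
  with enat have "n \<ge> 1" "n \<noteq> 1" "n \<noteq> 2"
    by (metis enat_ord_simps(1) one_enat_def, metis one_enat_def, metis numeral_eq_enat)
  then have "n \<ge> 3" by simp
  then have "cos (pi / n) > 0" by (intro cos_gt_zero) (auto simp: field_simps)
  with enat show ?thesis by (simp add: coxeter_weight_def)
qed (simp add: coxeter_weight_def)

definition twisted_form ::
    "('a \<Rightarrow> 'a \<Rightarrow> enat) \<Rightarrow> ('a \<Rightarrow> 'a \<Rightarrow> real) \<Rightarrow> 'a \<Rightarrow> 'a \<Rightarrow> real" where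
  "twisted_form m \<tau> s t = (if s = t then 2 else - coxeter_weight (m s t) * \<tau> s t)"

lemma act_presentation_equiv:
  assumes "finite S" "coxeter_matrix S m" and \<tau>: "\<And>s t. s \<noteq> t \<Longrightarrow> \<tau> s t * \<tau> t s = 1"
    and "presentation_equiv S m u v"
  shows "act S (twisted_form m \<tau>) u = act S (twisted_form m \<tau>) v"
proof -
  let ?a = "twisted_form m \<tau>"
  have del: "act S ?a x = act S ?a y" if "relator_deletion S m x y" for x y
    using that
  proof cases
    case (1 u v s t k)
    have "((reflection S ?a s \<circ> reflection S ?a t) ^^ k) z = z" for z
    proof (cases "s = t")
      case True
      then have "enat k = 1" using 1 assms(2) unfolding coxeter_matrix_def by metis
      then have "k = 1" by (simp add: one_enat_def)
      with True 1 assms(1) show ?thesis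
        by (simp add: reflection_involution twisted_form_def)
    next
      case False
      have "1 \<le> enat k" "enat k \<noteq> 1" "m t s = enat k"
        using 1 False assms(2) unfolding coxeter_matrix_def by metis+
      then have "k \<ge> 2" by (auto simp: one_enat_def)
      moreover have "\<tau> s t \<noteq> 0" using \<tau>[OF False] by force
      moreover from this have "\<tau> t s = 1 / \<tau> s t"
        using \<tau>[OF False] by (simp add: field_simps)
      ultimately show ?thesis
        using 1 False assms(1) \<open>m t s = enat k\<close>
        by (intro dihedral_relation[where \<tau> = "\<tau> s t"])
          (auto simp: twisted_form_def coxeter_weight_def)
    qed
    with 1 show ?thesis by (auto simp: act_relator)
  qed
  from assms(4) show ?thesis unfolding presentation_equiv_def
    by (induction rule: equivclp_induct) (use del in auto)
qed

section \<open>Determinants of kernels on the letters of a word\<close>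

text \<open>
  The matrix of a kernel, with rows and columns enumerated by two lists. Two different
  enumerations are allowed so that a base change between the orders given by two Coxeter words is
  again a matrix of this form.
\<close>

definition kernel_mat :: "'a list \<Rightarrow> 'a list \<Rightarrow> ('a \<Rightarrow> 'a \<Rightarrow> real) \<Rightarrow> real mat" where
  "kernel_mat es fs f = mat (length es) (length fs) (\<lambda>(i, j). f (es ! i) (fs ! j))"

lemma kernel_mat_carrier [simp]: "kernel_mat es fs f \<in> carrier_mat (length es) (length fs)"
  by (simp add: kernel_mat_def)

lemma kernel_mat_cong:
  "(\<And>i j. i \<in> set es \<Longrightarrow> j \<in> set fs \<Longrightarrow> f i j = g i j) \<Longrightarrow> kernel_mat es fs f = kernel_mat es fs g"
  by (auto simp: kernel_mat_def)

lemma sum_nth: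
  "distinct w \<Longrightarrow> (\<Sum>k = 0..<length w. f (w ! k)) = (\<Sum>x\<in>set w. f x)"
  using sum.reindex_bij_betw[OF bij_betw_nth[of w "{0..<length w}" "set w"], of f]
  by (auto simp: atLeast0LessThan)

lemma kernel_mat_mult:
  assumes "distinct fs"
  shows "kernel_mat es fs f * kernel_mat fs gs g
    = kernel_mat es gs (\<lambda>i j. \<Sum>l\<in>set fs. f i l * g l j)"
proof (rule eq_matI)
  fix i j assume "i < dim_row (kernel_mat es gs (\<lambda>i j. \<Sum>l\<in>set fs. f i l * g l j))"
    "j < dim_col (kernel_mat es gs (\<lambda>i j. \<Sum>l\<in>set fs. f i l * g l j))"
  then show "(kernel_mat es fs f * kernel_mat fs gs g) $$ (i, j)
    = kernel_mat es gs (\<lambda>i j. \<Sum>l\<in>set fs. f i l * g l j) $$ (i, j)"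
    using sum_nth[OF assms, of "\<lambda>l. f (es ! i) l * g l (gs ! j)"]
    by (simp add: kernel_mat_def scalar_prod_def)
qed (auto simp: kernel_mat_def)

lemma kernel_mat_one: "distinct es \<Longrightarrow> kernel_mat es es (\<lambda>i j. of_bool (i = j)) = 1\<^sub>m (length es)"
  by (rule eq_matI) (auto simp: kernel_mat_def nth_eq_iff_index_eq)

lemma det_kernel_mat:
  "det (kernel_mat w w f)
    = (\<Sum>p | p permutes {0..<length w}. signof p * (\<Prod>i = 0..<length w. f (w ! i) (w ! p i)))"
  unfolding det_def'[OF kernel_mat_carrier]
proof (intro sum.cong refl arg_cong2[where f = "(*)"] prod.cong)
  fix p i assume "p \<in> {p. p permutes {0..<length w}}" "i \<in> {0..<length w}"
  then have "p i < length w" using permutes_in_image[of p "{0..<length w}" i] by auto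
  then show "kernel_mat w w f $$ (i, p i) = f (w ! i) (w ! p i)"
    using \<open>i \<in> _\<close> by (simp add: kernel_mat_def)
qed

lemma det_scale_rows:
  assumes "distinct w"
  shows "det (kernel_mat w w (\<lambda>i j. r i * f i j)) = (\<Prod>i\<in>set w. r i) * det (kernel_mat w w f)"
proof -
  have "(\<Prod>i = 0..<length w. r (w ! i)) = (\<Prod>i\<in>set w. r i)"
    using prod.reindex_bij_betw[OF bij_betw_nth[of w "{0..<length w}" "set w"], of r] assms
    by (auto simp: atLeast0LessThan)
  then show ?thesis
    unfolding det_kernel_mat by (simp add: prod.distrib sum_distrib_left algebra_simps)
qed

lemma tendsto_det_kernel_mat:
  assumes "\<And>i j. \<lbrakk>i \<in> set w; j \<in> set w\<rbrakk> \<Longrightarrow> ((\<lambda>x. f x i j) \<longlongrightarrow> g i j) F"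
  shows "((\<lambda>x. det (kernel_mat w w (f x))) \<longlongrightarrow> det (kernel_mat w w g)) F"
  unfolding det_kernel_mat
proof (intro tendsto_sum tendsto_mult tendsto_const tendsto_prod assms)
  fix p i assume "p \<in> {p. p permutes {0..<length w}}" "i \<in> {0..<length w}"
  then show "w ! p i \<in> set w" using permutes_in_image[of p "{0..<length w}" i] by auto
qed auto

lemma det_kernel_mat_nonzero:
  assumes "distinct w"
    and inj: "\<And>v. (\<And>i. i \<in> set w \<Longrightarrow> (\<Sum>j\<in>set w. f i j * v j) = 0) \<Longrightarrow> \<forall>i\<in>set w. v i = 0"
  shows "det (kernel_mat w w f) \<noteq> 0"
proof
  assume "det (kernel_mat w w f) = 0"
  then obtain x where x: "x \<in> carrier_vec (length w)" "x \<noteq> 0\<^sub>v (length w)"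
      "kernel_mat w w f *\<^sub>v x = 0\<^sub>v (length w)"
    using det_0_iff_vec_prod_zero[OF kernel_mat_carrier] by blast
  define v where "v l = x $ pos w l" for l
  have v: "v (w ! k) = x $ k" if "k < length w" for k
    using that assms(1) by (simp add: v_def pos_nth)
  have "(\<Sum>j\<in>set w. f i j * v j) = 0" if "i \<in> set w" for i
  proof -
    obtain k where k: "k < length w" "i = w ! k" using \<open>i \<in> set w\<close> by (metis in_set_conv_nth)
    have "(\<Sum>j\<in>set w. f i j * v j) = (\<Sum>l = 0..<length w. f i (w ! l) * x $ l)"
      unfolding sum_nth[OF assms(1), symmetric] by (simp add: v)
    also have "\<dots> = (kernel_mat w w f *\<^sub>v x) $ k"
      using k x(1) by (simp add: kernel_mat_def scalar_prod_def)
    finally show ?thesis using x(3) k by simp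
  qed
  then have "\<forall>i\<in>set w. v i = 0" by (rule inj)
  then have "x $ k = 0" if "k < length w" for k using v[OF that] that by simp
  then have "x = 0\<^sub>v (length w)" using x(1) by (intro eq_vecI) auto
  with x(2) show False by simp
qed

section \<open>Characteristic polynomials of Coxeter elements\<close>

abbreviation act_entry where
  "act_entry S a w i j \<equiv> act S a w (\<lambda>l. of_bool (l = j)) i"

lemma act_eq_sum:
  assumes "finite S" "i \<in> S" "set w \<subseteq> S"
  shows "act S a w v i = (\<Sum>j\<in>S. act_entry S a w i j * v j)"
  using assms(2,3)
proof (induction w arbitrary: i)
  case Nil
  have "(\<Sum>j\<in>S. of_bool (i = j) * v j) = (\<Sum>j\<in>S. if i = j then v j else 0)"
    by (intro sum.cong) auto
  with Nil assms(1) show ?case by simp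
next
  case (Cons s w)
  have "pairing S a s (act S a w v) = (\<Sum>l\<in>S. \<Sum>j\<in>S. a s l * act_entry S a w l j * v j)"
    unfolding pairing_def using Cons by (intro sum.cong) (auto simp: sum_distrib_left mult.assoc)
  also have "\<dots> = (\<Sum>j\<in>S. \<Sum>l\<in>S. a s l * act_entry S a w l j * v j)"
    by (rule sum.swap)
  also have "\<dots> = (\<Sum>j\<in>S. pairing S a s (act S a w (\<lambda>l. of_bool (l = j))) * v j)"
    by (simp add: pairing_def sum_distrib_right)
  finally show ?case
    using Cons by (auto simp: reflection_def left_diff_distrib sum_subtractf)
qed

lemma act_entry_append:
  assumes "finite S" "i \<in> S" "set u \<subseteq> S"
  shows "(\<Sum>l\<in>S. act_entry S a u i l * act_entry S a w l j) = act_entry S a (u @ w) i j"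
  using act_eq_sum[OF assms, of a "act S a w (\<lambda>l. of_bool (l = j))"] by simp

lemma act_notin: "l \<notin> set w \<Longrightarrow> act S a w v l = v l"
  by (induction w) (auto simp: reflection_def)

definition upper_part :: "'a list \<Rightarrow> ('a \<Rightarrow> 'a \<Rightarrow> real) \<Rightarrow> 'a \<Rightarrow> 'a \<Rightarrow> real" where
  "upper_part w a i j = (if i = j then 1 else if pos w i < pos w j then a i j else 0)"

definition lower_part :: "'a list \<Rightarrow> ('a \<Rightarrow> 'a \<Rightarrow> real) \<Rightarrow> 'a \<Rightarrow> 'a \<Rightarrow> real" where
  "lower_part w a i j = (if i = j then 1 else if pos w j < pos w i then a i j else 0)"

text \<open>
  This is \<open>U c = - L\<close>. The product applies its letters from the last to the first. When the
  turn of \<open>i\<close> comes, the later letters have their final coordinates and the earlier ones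
  their initial coordinates; the coordinate at \<open>i\<close> changes sign and loses \<open>a i l\<close> times the
  coordinate at every other \<open>l\<close>.
\<close>

lemma upper_part_act:
  assumes "distinct w" "i \<in> set w" "a i i = 2"
  shows "(\<Sum>l\<in>set w. upper_part w a i l * act (set w) a w v l)
    = - (\<Sum>l\<in>set w. lower_part w a i l * v l)"
proof -
  obtain xs ys where w: "w = xs @ i # ys" using assms(2) by (meson split_list)
  let ?S = "set w"
  define z where "z = act ?S a ys v"
  define y where "y = act ?S a w v"
  have y: "y l = reflection ?S a i z l" if "l \<notin> set xs" for l
  proof -
    have "y = act ?S a xs (reflection ?S a i z)" using w unfolding y_def z_def
      by (metis act_simps(2,3))
    then show ?thesis using that by (simp add: act_notin)
  qed
  have zi: "z i = v i" using assms(1) w by (simp add: z_def act_notin)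
  have yi: "y i = v i - pairing ?S a i z"
    using y[of i] assms(1) w zi by (auto simp: reflection_def)
  have termwise: "upper_part w a i l * y l + lower_part w a i l * v l
      = a i l * z l + (if l = i then y i - v i else 0)" if l: "l \<in> ?S" for l
  proof -
    consider "l = i" | "l \<in> set xs" "l \<noteq> i" | "l \<in> set ys" "l \<noteq> i" "l \<notin> set xs" 
      using l w by auto
    then show ?thesis
    proof cases
      case 1
      then show ?thesis using zi assms(3) by (simp add: upper_part_def lower_part_def)
    next
      case 2
      then have "pos w l < pos w i" "l \<notin> set ys" "i \<notin> set xs"
        using assms(1) w pos_less_length[of xs l] by (auto simp: pos_append pos_Cons)
      then show ?thesis using 2 by (simp add: upper_part_def lower_part_def z_def act_notin)
    next
      case 3
      then have "pos w i < pos w l"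
        using assms(1) w by (auto simp: pos_append pos_Cons)
      then show ?thesis using 3 y[of l]
        by (simp add: upper_part_def lower_part_def reflection_def)
    qed
  qed
  have "(\<Sum>l\<in>?S. upper_part w a i l * y l) + (\<Sum>l\<in>?S. lower_part w a i l * v l)
      = (\<Sum>l\<in>?S. a i l * z l + (if l = i then y i - v i else 0))"
    unfolding sum.distrib[symmetric] using termwise by (intro sum.cong) auto
  also have "\<dots> = pairing ?S a i z + (y i - v i)"
    using assms(2) by (simp add: sum.distrib pairing_def)
  finally show ?thesis using yi by (simp add: y_def)
qed

text \<open>
  By \<open>upper_part_act\<close>, \<open>U (x - c) = x U + L\<close>; in the order of \<open>w\<close> the matrix \<open>U\<close> is unitriangular
  and has determinant \<open>1\<close>.
\<close>

lemma char_poly_coxeter_word: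
  assumes "distinct w" "\<And>i. a i i = 2"
  shows "det (kernel_mat w w (\<lambda>i j. x * of_bool (i = j) - act_entry (set w) a w i j))
    = det (kernel_mat w w (\<lambda>i j. x * upper_part w a i j + lower_part w a i j))"
proof -
  let ?U = "kernel_mat w w (upper_part w a)"
  let ?A = "kernel_mat w w (\<lambda>i j. x * of_bool (i = j) - act_entry (set w) a w i j)"
  have "upper_triangular ?U"
    using assms(1) by (auto simp: upper_triangular_def kernel_mat_def upper_part_def pos_nth nth_eq_iff_index_eq)
  then have "det ?U = prod_list (diag_mat ?U)" using kernel_mat_carrier by (rule det_upper_triangular)
  also have "\<dots> = 1"
    by (simp add: prod_list_diag_prod kernel_mat_def upper_part_def)
  finally have "det ?U = 1" .
  moreover have "?U * ?A = kernel_mat w w (\<lambda>i j. x * upper_part w a i j + lower_part w a i j)"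
    unfolding kernel_mat_mult[OF assms(1)]
  proof (rule kernel_mat_cong)
    fix i j assume ij: "i \<in> set w" "j \<in> set w"
    have "(\<Sum>l\<in>set w. upper_part w a i l * (x * of_bool (l = j) - act_entry (set w) a w l j))
      = (\<Sum>l\<in>set w. if l = j then x * upper_part w a i j else 0)
        - (\<Sum>l\<in>set w. upper_part w a i l * act_entry (set w) a w l j)"
      unfolding sum_subtractf[symmetric] by (intro sum.cong) (auto simp: algebra_simps)
    also have "\<dots> = x * upper_part w a i j + (\<Sum>l\<in>set w. if l = j then lower_part w a i j else 0)"
      unfolding upper_part_act[where a = a, OF assms(1) ij(1) assms(2)] using ij
      by (auto intro!: sum.cong)
    finally show "(\<Sum>l\<in>set w. upper_part w a i l * (x * of_bool (l = j) - act_entry (set w) a w l j))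
      = x * upper_part w a i j + lower_part w a i j" using ij by simp
  qed
  ultimately show ?thesis
    using det_mult[of ?U "length w" ?A] by simp
qed

text \<open>
  Invariance of the characteristic polynomial under conjugation, where each side is written in the
  basis order of its own Coxeter word, so that \<open>char_poly_coxeter_word\<close> applies to both.
\<close>

lemma char_poly_conjugate:
  assumes w: "distinct w" "set w = S" and w': "distinct w'" "set w' = S" and u: "set u \<subseteq> S"
    and inv: "act S a (u @ rev u) = act S a []"
    and conj: "act S a (u @ w @ rev u) = act S a w'"
  shows "det (kernel_mat w w (\<lambda>i j. x * of_bool (i = j) - act_entry S a w i j))
    = det (kernel_mat w' w' (\<lambda>i j. x * of_bool (i = j) - act_entry S a w' i j))"
proof -
  have fin: "finite S" using w(2) by auto
  have len: "length w = length w'" using w w' by (metis distinct_card)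
  let ?G = "kernel_mat w' w (act_entry S a u)" and ?H = "kernel_mat w w' (act_entry S a (rev u))"
  let ?A = "kernel_mat w w (\<lambda>i j. x * of_bool (i = j) - act_entry S a w i j)"
  have carrier: "?G \<in> carrier_mat (length w) (length w)" "?H \<in> carrier_mat (length w) (length w)"
      "?A \<in> carrier_mat (length w) (length w)"
    using kernel_mat_carrier[of w' w] kernel_mat_carrier[of w w'] kernel_mat_carrier[of w w]
    unfolding len by blast+
  have "?G * ?H = kernel_mat w' w' (\<lambda>i j. of_bool (i = j))"
    unfolding kernel_mat_mult[OF w(1)] w(2)
  proof (rule kernel_mat_cong)
    fix i j assume "i \<in> set w'"
    then show "(\<Sum>l\<in>S. act_entry S a u i l * act_entry S a (rev u) l j) = of_bool (i = j)"
      using act_entry_append[OF fin _ u, of i a "rev u" j] inv w'(2) by simp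
  qed
  then have "?G * ?H = 1\<^sub>m (length w')" using w' by (simp add: kernel_mat_one)
  then have GH: "det ?G * det ?H = 1"
    using det_mult[OF carrier(1,2)] by simp
  have "?G * ?A = kernel_mat w' w (\<lambda>i j. x * act_entry S a u i j - act_entry S a (u @ w) i j)"
    unfolding kernel_mat_mult[OF w(1)] w(2)
  proof (rule kernel_mat_cong)
    fix i j assume ij: "i \<in> set w'" "j \<in> set w"
    have "(\<Sum>l\<in>S. act_entry S a u i l * (x * of_bool (l = j) - act_entry S a w l j))
      = (\<Sum>l\<in>S. if l = j then x * act_entry S a u i j else 0)
        - (\<Sum>l\<in>S. act_entry S a u i l * act_entry S a w l j)"
      unfolding sum_subtractf[symmetric] by (intro sum.cong) (auto simp: algebra_simps)
    then show "(\<Sum>l\<in>S. act_entry S a u i l * (x * of_bool (l = j) - act_entry S a w l j))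
      = x * act_entry S a u i j - act_entry S a (u @ w) i j"
      using ij w w' fin u act_entry_append[OF fin _ u, of i a w j] by auto
  qed
  also have "\<dots> * ?H = kernel_mat w' w' (\<lambda>i j. x * of_bool (i = j) - act_entry S a w' i j)"
    unfolding kernel_mat_mult[OF w(1)] w(2)
  proof (rule kernel_mat_cong)
    fix i j assume ij: "i \<in> set w'" "j \<in> set w'"
    have i: "i \<in> S" using ij w' by simp
    have uw: "set (u @ w) \<subseteq> S" using u w by auto
    have "(\<Sum>l\<in>S. (x * act_entry S a u i l - act_entry S a (u @ w) i l) * act_entry S a (rev u) l j)
      = x * (\<Sum>l\<in>S. act_entry S a u i l * act_entry S a (rev u) l j)
        - (\<Sum>l\<in>S. act_entry S a (u @ w) i l * act_entry S a (rev u) l j)"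
      unfolding sum_distrib_left sum_subtractf[symmetric]
      by (intro sum.cong) (auto simp: algebra_simps)
    also have "\<dots> = x * of_bool (i = j) - act_entry S a w' i j"
      unfolding act_entry_append[OF fin i u] act_entry_append[OF fin i uw]
      using inv conj by simp
    finally show "(\<Sum>l\<in>S. (x * act_entry S a u i l - act_entry S a (u @ w) i l)
        * act_entry S a (rev u) l j) = x * of_bool (i = j) - act_entry S a w' i j" .
  qed
  finally have "det (?G * ?A * ?H)
    = det (kernel_mat w' w' (\<lambda>i j. x * of_bool (i = j) - act_entry S a w' i j))" by simp
  moreover have "det (?G * ?A * ?H) = det ?G * det ?A * det ?H"
    using det_mult[OF mult_carrier_mat[OF carrier(1,3)] carrier(2)] det_mult[OF carrier(1,3)] by simp
  moreover have "det ?G * det ?A * det ?H = det ?A"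
    unfolding mult.assoc mult.commute[of "det ?A"] unfolding mult.assoc[symmetric] GH
    by (rule mult_1)
  ultimately show ?thesis by simp
qed

section \<open>Counting the forward edges of a cycle\<close>

text \<open>
  With weight \<open>inverse (x ^ 2)\<close> on the arcs of the cycle, the entry of \<open>x U + L\<close> at an arc has
  order \<open>x\<^sup>-\<^sup>1\<close> or \<open>x\<^sup>-\<^sup>2\<close>, according to whether the arc follows the orientation, while the rest of
  its row stays bounded. So this entry dominates its row as \<open>x\<close> tends to \<open>0\<close>. Weight
  \<open>inverse x\<close> would not suffice, as an arc along the orientation would lose it to the factor \<open>x\<close>.
\<close>

definition cycle_twist :: "'a set \<Rightarrow> ('a \<Rightarrow> 'a) \<Rightarrow> real \<Rightarrow> 'a \<Rightarrow> 'a \<Rightarrow> real" where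
  "cycle_twist C \<sigma> x i j =
     (if i \<in> C \<and> j = \<sigma> i then inverse (x ^ 2) else if j \<in> C \<and> i = \<sigma> j then x ^ 2 else 1)"

lemma cycle_twist_swap:
  assumes "x \<noteq> 0" "\<And>i. i \<in> C \<Longrightarrow> \<sigma> (\<sigma> i) \<noteq> i"
  shows "cycle_twist C \<sigma> x i j * cycle_twist C \<sigma> x j i = 1"
  using assms(1) assms(2)[of i] assms(2)[of j] by (auto simp: cycle_twist_def)

text \<open>
  The exponent \<open>n\<close> for which \<open>x ^ n\<close> times the entry of \<open>x U + L\<close> at the arc from \<open>i\<close> to \<open>j\<close> of
  the cycle is constant in \<open>x\<close>.
\<close>

definition arc_exponent :: "'a list \<Rightarrow> 'a \<Rightarrow> 'a \<Rightarrow> nat" where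
  "arc_exponent w i j = (if pos w i < pos w j then 1 else 2)"

text \<open>
  Scaling the row of each \<open>i\<close> in \<open>C\<close> by its \<open>arc_exponent\<close> power of \<open>x\<close> makes all entries
  converge. In the limit matrix \<open>Q\<close> the row of \<open>i \<in> C\<close> has its only nonzero entry at \<open>\<sigma> i\<close>,
  and the other rows are lower unitriangular in the order of \<open>w\<close>. Therefore \<open>Q\<close> is invertible: a vector
  in its kernel vanishes on \<open>C\<close>, because \<open>\<sigma>\<close> maps onto \<open>C\<close>, and then at all other letters, by
  induction along \<open>w\<close>.
\<close>

lemma char_poly_asymptotics:
  fixes m :: "'a \<Rightarrow> 'a \<Rightarrow> enat"
  assumes w: "distinct w" and C: "C \<subseteq> set w" and bij: "bij_betw \<sigma> C C"
    and no2: "\<And>i. i \<in> C \<Longrightarrow> \<sigma> (\<sigma> i) \<noteq> i"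
    and wt: "\<And>i. i \<in> C \<Longrightarrow> coxeter_weight (m i (\<sigma> i)) \<noteq> 0"
  obtains c where "c \<noteq> 0"
    and "((\<lambda>x. x ^ (\<Sum>i\<in>C. arc_exponent w i (\<sigma> i)) *
           det (kernel_mat w w (\<lambda>i j. x * upper_part w (twisted_form m (cycle_twist C \<sigma> x)) i j
              + lower_part w (twisted_form m (cycle_twist C \<sigma> x)) i j))) \<longlongrightarrow> c) (at_right 0)"
proof -
  define N where "N i j = coxeter_weight (m i j)" for i j
  let ?a = "\<lambda>x. twisted_form m (cycle_twist C \<sigma> x)"
  define M where "M x i j = x * upper_part w (?a x) i j + lower_part w (?a x) i j" for x i j
  define r where "r x i = (if i \<in> C then x ^ arc_exponent w i (\<sigma> i) else 1)" for x :: real and i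
  define Q where "Q i j = (if i \<in> C then (if j = \<sigma> i then - N i j else 0)
      else if i = j then 1 else if pos w i < pos w j then 0 else - N i j)" for i j
  have \<sigma>C: "\<sigma> i \<in> C" if "i \<in> C" for i using bij that by (auto simp: bij_betw_def)
  have M: "M x i j = (if i = j then x + 1
      else (if pos w i < pos w j then x else 1) * (- N i j * cycle_twist C \<sigma> x i j))"
    if "i \<in> set w" "j \<in> set w" for x i j
    using pos_eq_iff[OF that]
    by (auto simp: M_def upper_part_def lower_part_def twisted_form_def N_def)
  have entry: "((\<lambda>x. r x i * M x i j) \<longlongrightarrow> Q i j) (at_right 0)"
    if ij: "i \<in> set w" "j \<in> set w" for i j
  proof -
    consider "i \<notin> C" "i = j" | "i \<notin> C" "i \<noteq> j" | "i \<in> C" "j = \<sigma> i" | "i \<in> C" "j \<noteq> \<sigma> i" "i = j"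
      | "i \<in> C" "j \<noteq> \<sigma> i" "i \<noteq> j" by blast
    then show ?thesis
    proof cases
      case 1
      then show ?thesis by (auto simp: M[OF ij(2,2)] r_def Q_def intro!: tendsto_eq_intros)
    next
      case 2
      then have "cycle_twist C \<sigma> x i j = 1" for x using \<sigma>C by (auto simp: cycle_twist_def)
      with 2 show ?thesis by (auto simp: M[OF ij] r_def Q_def intro!: tendsto_eq_intros)
    next
      case 3
      have "i \<noteq> j" using 3 no2[of i] by auto
      have "r x i * M x i j = Q i j" if "x > 0" for x :: real
        unfolding M[OF ij] using that 3 \<open>i \<noteq> j\<close>
        by (auto simp: r_def Q_def cycle_twist_def arc_exponent_def field_simps power2_eq_square)
      then show ?thesis
        by (intro tendsto_eventually) (auto simp: eventually_at_right_less intro: eventually_at_rightI[of 0 1])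
    next
      case 4
      then show ?thesis
        by (auto simp: M[OF ij(2,2)] r_def Q_def arc_exponent_def intro!: tendsto_eq_intros)
    next
      case 5
      then have "cycle_twist C \<sigma> x i j = (if j \<in> C \<and> i = \<sigma> j then x ^ 2 else 1)" for x
        by (auto simp: cycle_twist_def)
      with 5 show ?thesis
        unfolding M[OF ij]
        by (cases "pos w i < pos w j"; cases "j \<in> C \<and> i = \<sigma> j")
          (auto simp: r_def Q_def arc_exponent_def intro!: tendsto_eq_intros)
    qed
  qed
  have lim: "((\<lambda>x. det (kernel_mat w w (\<lambda>i j. r x i * M x i j))) \<longlongrightarrow> det (kernel_mat w w Q)) (at_right 0)"
    using entry by (rule tendsto_det_kernel_mat)
  have scale: "det (kernel_mat w w (\<lambda>i j. r x i * M x i j))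
      = x ^ (\<Sum>i\<in>C. arc_exponent w i (\<sigma> i)) * det (kernel_mat w w (M x))" for x
  proof -
    have "(\<Prod>i\<in>set w. r x i) = (\<Prod>i\<in>C. r x i)"
      using C by (intro prod.mono_neutral_right) (auto simp: r_def)
    also have "\<dots> = x ^ (\<Sum>i\<in>C. arc_exponent w i (\<sigma> i))"
      by (simp add: r_def power_sum)
    finally show ?thesis by (simp add: det_scale_rows[OF w])
  qed
  have nonzero: "det (kernel_mat w w Q) \<noteq> 0"
  proof (rule det_kernel_mat_nonzero[OF w], rule ballI)
    fix v i assume 0: "\<And>i. i \<in> set w \<Longrightarrow> (\<Sum>j\<in>set w. Q i j * v j) = 0"
    have vC: "v j = 0" if "j \<in> C" for j
    proof -
      obtain i where i: "i \<in> C" "j = \<sigma> i" using bij \<open>j \<in> C\<close> by (auto simp: bij_betw_def)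
      have "(\<Sum>l\<in>set w. Q i l * v l) = (\<Sum>l\<in>set w. if l = j then - N i j * v j else 0)"
        using i by (intro sum.cong) (auto simp: Q_def)
      also have "\<dots> = - N i j * v j" using C that by auto
      finally show ?thesis using 0[of i] i C wt[of i] by (auto simp: N_def)
    qed
    assume "i \<in> set w"
    then show "v i = 0"
    proof (induction "pos w i" arbitrary: i rule: less_induct)
      case less
      show ?case
      proof (cases "i \<in> C")
        case False
        have "Q i j * v j = (if j = i then v i else 0)" if "j \<in> set w" for j
          using False less.hyps[of j] less.prems that pos_eq_iff[OF less.prems that]
          by (auto simp: Q_def)
        then have "(\<Sum>j\<in>set w. Q i j * v j) = (\<Sum>j\<in>set w. if j = i then v i else 0)"
          by (intro sum.cong) auto
        with 0[OF less.prems] less.prems show ?thesis by simp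
      qed (rule vC)
    qed
  qed
  have "M x = (\<lambda>i j. x * upper_part w (?a x) i j + lower_part w (?a x) i j)" for x
    by (simp add: M_def fun_eq_iff)
  with lim[unfolded scale] nonzero show ?thesis by (intro that) simp_all
qed

lemma exponent_le_if_limit_nonzero:
  fixes f :: "real \<Rightarrow> real"
  assumes "((\<lambda>x. x ^ m * f x) \<longlongrightarrow> c) (at_right 0)" "c \<noteq> 0"
    and "((\<lambda>x. x ^ n * f x) \<longlongrightarrow> d) (at_right 0)"
  shows "m \<le> n"
proof (rule ccontr)
  assume "\<not> m \<le> n"
  then have "((\<lambda>x. x ^ (m - n) * (x ^ n * f x)) \<longlongrightarrow> 0 ^ (m - n) * d) (at_right 0)"
    by (intro tendsto_mult assms(3)) (auto intro!: tendsto_eq_intros)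
  moreover have "x ^ (m - n) * (x ^ n * f x) = x ^ m * f x" for x
    using \<open>\<not> m \<le> n\<close> by (simp flip: power_add mult.assoc)
  ultimately have "((\<lambda>x. x ^ m * f x) \<longlongrightarrow> 0) (at_right 0)"
    using \<open>\<not> m \<le> n\<close> by (simp add: power_0_left)
  then have "c = 0" using assms(1) tendsto_unique[of "at_right (0 :: real)"] by force
  with assms(2) show False by simp
qed

section \<open>Conjugacy of Coxeter elements\<close>

text \<open>
  The conjugacy invariant: for every \<open>x > 0\<close> the two Coxeter words have the same determinant
  \<open>det (x U + L)\<close>, so the leading powers of \<open>x\<close> found in \<open>char_poly_asymptotics\<close> agree, and
  these determine the numbers of forward edges.
\<close>
lemma ahead_sum_eq_if_conjugate:
  fixes m :: "'a \<Rightarrow> 'a \<Rightarrow> enat"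
  assumes "finite S" and m: "coxeter_matrix S m"
    and w: "distinct w" "set w = S" and w': "distinct w'" "set w' = S" and u: "set u \<subseteq> S"
    and inv: "presentation_equiv S m (u @ rev u) []"
    and conj: "presentation_equiv S m (u @ w @ rev u) w'"
    and C: "C \<subseteq> S" and bij: "bij_betw \<sigma> C C"
    and edge: "\<And>i. i \<in> C \<Longrightarrow> i \<noteq> \<sigma> i \<and> m i (\<sigma> i) \<noteq> 2"
    and no2: "\<And>i. i \<in> C \<Longrightarrow> \<sigma> (\<sigma> i) \<noteq> i"
  shows "(\<Sum>i\<in>C. ahead w i (\<sigma> i)) = (\<Sum>i\<in>C. ahead w' i (\<sigma> i))"
proof -
  let ?a = "\<lambda>x. twisted_form m (cycle_twist C \<sigma> x)"
  let ?D = "\<lambda>w x. det (kernel_mat w w (\<lambda>i j. x * upper_part w (?a x) i j + lower_part w (?a x) i j))"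
  let ?n = "\<lambda>w. \<Sum>i\<in>C. arc_exponent w i (\<sigma> i)"
  have D: "?D w x = ?D w' x" if "x > 0" for x
  proof -
    have tw: "cycle_twist C \<sigma> x s t * cycle_twist C \<sigma> x t s = 1" for s t
      by (rule cycle_twist_swap) (use that no2 in auto)
    have "det (kernel_mat w w (\<lambda>i j. x * of_bool (i = j) - act_entry S (?a x) w i j))
      = det (kernel_mat w' w' (\<lambda>i j. x * of_bool (i = j) - act_entry S (?a x) w' i j))"
      using w w' u
    proof (rule char_poly_conjugate)
      show "act S (?a x) (u @ rev u) = act S (?a x) []"
        by (rule act_presentation_equiv[OF assms(1) m tw inv])
      show "act S (?a x) (u @ w @ rev u) = act S (?a x) w'"
        by (rule act_presentation_equiv[OF assms(1) m tw conj])
    qed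
    moreover have diag: "\<And>i. ?a x i i = 2" by (simp add: twisted_form_def)
    ultimately show ?thesis
      using char_poly_coxeter_word[of w "?a x" x, OF w(1) diag] 
        char_poly_coxeter_word[of w' "?a x" x, OF w'(1) diag] w(2) w'(2) by simp
  qed
  have wt: "coxeter_weight (m i (\<sigma> i)) \<noteq> 0" if "i \<in> C" for i
  proof -
    have "i \<in> S" "\<sigma> i \<in> S" using that C bij by (auto simp: bij_betw_def)
    then have "m i (\<sigma> i) \<ge> 1" "m i (\<sigma> i) \<noteq> 1"
      using m edge[OF that] unfolding coxeter_matrix_def by metis+
    then show ?thesis using coxeter_weight_pos edge[OF that] by (metis less_irrefl)
  qed
  obtain c where c: "c \<noteq> 0" "((\<lambda>x. x ^ ?n w * ?D w x) \<longlongrightarrow> c) (at_right 0)"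
    using char_poly_asymptotics[of w C \<sigma> m] w C bij no2 wt by blast
  obtain c' where c': "c' \<noteq> 0" "((\<lambda>x. x ^ ?n w' * ?D w' x) \<longlongrightarrow> c') (at_right 0)"
    using char_poly_asymptotics[of w' C \<sigma> m] w' C bij no2 wt by blast
  have "eventually (\<lambda>x. x ^ ?n w' * ?D w' x = x ^ ?n w' * ?D w x) (at_right 0)"
    using D by (intro eventually_at_rightI[of 0 1]) auto
  then have c'': "((\<lambda>x. x ^ ?n w' * ?D w x) \<longlongrightarrow> c') (at_right 0)"
    using c'(2) by (rule tendsto_cong[THEN iffD1])
  have "?n w = ?n w'"
    using exponent_le_if_limit_nonzero[OF c(2,1) c''] exponent_le_if_limit_nonzero[OF c'' c'(1) c(2)] by simp
  moreover have "(\<Sum>i\<in>C. ahead v i (\<sigma> i)) = 2 * int (card C) - int (?n v)" for v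
  proof -
    have "(\<Sum>i\<in>C. ahead v i (\<sigma> i)) = (\<Sum>i\<in>C. 2 - int (arc_exponent v i (\<sigma> i)))"
      by (intro sum.cong) (auto simp: ahead_def arc_exponent_def)
    then show ?thesis by (simp add: sum_subtractf)
  qed
  ultimately show ?thesis by (simp only:)
qed

lemma (in group) conjugate_in_refl: "a \<in> carrier G \<Longrightarrow> conjugate_in G a a"
  unfolding conjugate_in_def by (rule bexI[of _ \<one>]) auto

lemma (in group) conjugate_in_trans:
  assumes "a \<in> carrier G" "conjugate_in G a b" "conjugate_in G b c"
  shows "conjugate_in G a c"
proof -
  obtain g h where g: "g \<in> carrier G" "b = g \<otimes> a \<otimes> inv g" and h: "h \<in> carrier G" "c = h \<otimes> b \<otimes> inv h"
    using assms unfolding conjugate_in_def by blast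
  have "c = (h \<otimes> g) \<otimes> a \<otimes> inv (h \<otimes> g)"
    using assms(1) g h by (simp add: m_assoc inv_mult_group)
  with g h show ?thesis unfolding conjugate_in_def by blast
qed

context coxeter_group
begin

lemma word_prod_simps [simp]:
  "word_prod W [] = \<one>" "word_prod W (s # w) = s \<otimes> word_prod W w"
  by (simp_all add: word_prod_def)

lemma word_prod_closed [simp]: "set w \<subseteq> S \<Longrightarrow> word_prod W w \<in> carrier W"
  using generators by (induction w) auto

lemma word_prod_append:
  "set u \<subseteq> S \<Longrightarrow> set v \<subseteq> S \<Longrightarrow> word_prod W (u @ v) = word_prod W u \<otimes> word_prod W v"
  using generators by (induction u) (auto simp: m_assoc subset_iff)

lemma rotation_step_conjugate:
  assumes "rotation_step W w w'" "set w \<subseteq> S"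
  shows "conjugate_in W (word_prod W w) (word_prod W w')"
  using assms(1)
proof cases
  case (rotation s v)
  have s: "s \<in> carrier W" "s \<in> S" "set v \<subseteq> S" using assms(2) generators rotation by auto
  have "word_prod W w' = inv s \<otimes> word_prod W w \<otimes> inv (inv s)"
    using s rotation by (simp add: word_prod_append m_assoc[symmetric])
  with s show ?thesis unfolding conjugate_in_def by (metis inv_closed)
next
  case (commutation s t u v)
  have st: "s \<in> S" "t \<in> S" "s \<in> carrier W" "t \<in> carrier W" "set u \<subseteq> S" "set v \<subseteq> S"
    using assms(2) generators commutation by auto
  then have "word_prod W w = word_prod W w'"
    using commutation by (simp add: word_prod_append m_assoc[symmetric])
  moreover have "conjugate_in W (word_prod W w) (word_prod W w)"
    using assms(2) by (simp add: conjugate_in_refl)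
  ultimately show ?thesis by simp
qed

lemma conjugate_if_rotation_equiv:
  assumes "rotation_equiv_words W w w'" "set w \<subseteq> S"
  shows "conjugate_in W (word_prod W w) (word_prod W w')"
proof -
  have "set w' \<subseteq> S \<and> conjugate_in W (word_prod W w) (word_prod W w')"
    using assms(1) unfolding rotation_equiv_words_def
  proof (induction rule: rtranclp_induct)
    case base
    then show ?case using assms(2) by (simp add: conjugate_in_refl)
  next
    case (step v v')
    have "set v' = set v" using step.hyps(2) by cases auto
    moreover have "conjugate_in W (word_prod W v) (word_prod W v')"
      using step by (intro rotation_step_conjugate) auto
    ultimately show ?case using step.IH assms(2) conjugate_in_trans word_prod_closed by metis
  qed
  then show ?thesis ..
qed

lemma generator_involution:
  assumes "s \<in> S"
  shows "s \<otimes> s = \<one>"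
proof -
  obtain m where m: "coxeter_matrix S m"
      "\<forall>u\<in>lists S. \<forall>v\<in>lists S. word_prod W u = word_prod W v \<longleftrightarrow> presentation_equiv S m u v"
    using presentation by blast
  have "m s s = enat 1" using m(1) assms unfolding coxeter_matrix_def one_enat_def by metis
  then have "relator_deletion S m ([] @ concat (replicate 1 [s, s]) @ []) ([] @ [])"
    using assms by (intro relator_deletion.intros) auto
  then have "presentation_equiv S m [s, s] []" by (auto simp: presentation_equiv_def)
  then have "word_prod W [s, s] = word_prod W []" using m(2)[rule_format, of "[s, s]" "[]"] assms by auto
  then show ?thesis using assms generators by auto
qed

lemma generators_commute:
  assumes "coxeter_matrix S m"
      "\<forall>u\<in>lists S. \<forall>v\<in>lists S. word_prod W u = word_prod W v \<longleftrightarrow> presentation_equiv S m u v"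
    and "s \<in> S" "t \<in> S" "m s t = 2"
  shows "s \<otimes> t = t \<otimes> s"
proof -
  have "relator_deletion S m ([] @ concat (replicate 2 [s, t]) @ []) ([] @ [])"
    using assms by (intro relator_deletion.intros) (auto simp: numeral_eq_enat)
  then have "presentation_equiv S m [s, t, s, t] []"
    by (auto simp: presentation_equiv_def numeral_2_eq_2)
  then have "word_prod W [s, t, s, t] = word_prod W []"
    using assms(2)[rule_format, of "[s, t, s, t]" "[]"] assms(3,4) by auto
  moreover have st: "s \<in> carrier W" "t \<in> carrier W" using assms generators by auto
  ultimately have "(s \<otimes> t) \<otimes> (s \<otimes> t) = \<one>" by (simp add: m_assoc)
  then have "s \<otimes> t = inv (s \<otimes> t)" using st by (metis inv_equality m_closed)
  also have "\<dots> = inv t \<otimes> inv s" using st by (simp add: inv_mult_group)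
  finally have "s \<otimes> t = inv t \<otimes> inv s" .
  moreover have "inv t = t" "inv s = s"
    using st generator_involution assms by (auto intro: inv_equality)
  ultimately show ?thesis by simp
qed

lemma word_prod_rev:
  assumes "set w \<subseteq> S"
  shows "word_prod W (rev w) = inv (word_prod W w)"
  using assms
proof (induction w)
  case (Cons s w)
  have "s \<in> carrier W" using Cons.prems generators by auto
  moreover from this have "inv s = s"
    using generator_involution Cons.prems by (intro inv_equality) auto
  ultimately show ?case using Cons by (simp add: word_prod_append inv_mult_group)
qed simp

lemma word_exists:
  assumes "g \<in> carrier W"
  obtains u where "set u \<subseteq> S" "word_prod W u = g"
proof -
  have "g \<in> generate W S" using assms generates by simp
  then have "\<exists>u. set u \<subseteq> S \<and> word_prod W u = g"
  proof induction
    case one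
    show ?case by (rule exI[of _ "[]"]) simp
  next
    case (incl s)
    then show ?case using generators by (intro exI[of _ "[s]"]) auto
  next
    case (inv s)
    then have "inv s = s" using generator_involution generators by (intro inv_equality) auto
    then show ?case using inv generators by (intro exI[of _ "[s]"]) auto
  next
    case (eng g h)
    then show ?case using word_prod_append by (metis le_sup_iff set_append)
  qed
  with that show ?thesis by blast
qed

text \<open>
  The orientations of the two words differ by a cochain that vanishes on cycles, hence by an
  integer potential; as \<open>S\<close> is finite, subtracting the minimum makes it a natural number.
\<close>

lemma rotation_equiv_if_conjugate:
  assumes "finite S" and w: "coxeter_word S w" and w': "coxeter_word S w'"
    and conj: "conjugate_in W (word_prod W w) (word_prod W w')"
  shows "rotation_equiv_words W w w'"
proof -
  obtain m where m: "coxeter_matrix S m"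
      "\<forall>u\<in>lists S. \<forall>v\<in>lists S. word_prod W u = word_prod W v \<longleftrightarrow> presentation_equiv S m u v"
    using presentation by blast
  have w: "distinct w" "set w = S" and w': "distinct w'" "set w' = S"
    using w w' by (auto simp: coxeter_word_def)
  obtain g where "g \<in> carrier W" and g: "word_prod W w' = g \<otimes> word_prod W w \<otimes> inv g"
    using conj unfolding conjugate_in_def by blast
  then obtain u where u: "set u \<subseteq> S" "word_prod W u = g" using word_exists by blast
  have "word_prod W (u @ w @ rev u) = word_prod W w'"
    using u w g \<open>g \<in> carrier W\<close>
    by (simp add: word_prod_append word_prod_rev m_assoc)
  then have conj: "presentation_equiv S m (u @ w @ rev u) w'"
    using m(2)[rule_format, of "u @ w @ rev u" w'] u w w' by (auto simp: in_lists_conv_set)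
  have "word_prod W (u @ rev u) = word_prod W []"
    using u \<open>g \<in> carrier W\<close> by (simp add: word_prod_append word_prod_rev)
  then have inv: "presentation_equiv S m (u @ rev u) []"
    using m(2)[rule_format, of "u @ rev u" "[]"] u by (auto simp: in_lists_conv_set)
  define E where "E x y \<longleftrightarrow> x \<in> S \<and> y \<in> S \<and> x \<noteq> y \<and> m x y \<noteq> 2" for x y
  define d where "d x y = ahead w x y - ahead w' x y" for x y
  have sym: "E y x" if "E x y" for x y
    using that m(1) unfolding E_def coxeter_matrix_def by metis
  have irrefl: "\<not> E x x" for x by (simp add: E_def)
  have anti: "d x y + d y x = 0" if "E x y" for x y
    using that w w' ahead_swap[of x w y] ahead_swap[of x w' y] by (auto simp: d_def E_def)
  have perm: "(\<Sum>i\<in>C. d i (\<sigma> i)) = 0"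
    if "bij_betw \<sigma> C C" "\<And>i. i \<in> C \<Longrightarrow> E i (\<sigma> i) \<and> \<sigma> (\<sigma> i) \<noteq> i" for C \<sigma>
  proof -
    have "(\<Sum>i\<in>C. ahead w i (\<sigma> i)) = (\<Sum>i\<in>C. ahead w' i (\<sigma> i))"
      by (rule ahead_sum_eq_if_conjugate[OF assms(1) m(1) w w' u(1) inv conj])
        (use that in \<open>auto simp: E_def\<close>)
    then show ?thesis by (simp add: d_def sum_subtractf)
  qed
  obtain h :: "'a \<Rightarrow> int" where h: "\<And>x y. E x y \<Longrightarrow> d x y = h x - h y"
  proof (rule potential_if_closed_walks_zero[of E d])
    fix xs assume "successively E xs" "xs \<noteq> []" "hd xs = last xs"
    then show "walk_sum d xs = 0"
      using closed_walk_sum_zero[of E d xs] irrefl anti perm by blast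
  qed (use sym anti in auto)
  define h' where "h' x = nat (h x - Min (h ` S))" for x
  have h': "int (h' x) = h x - Min (h ` S)" if "x \<in> S" for x
    using that assms(1) by (simp add: h'_def)
  show ?thesis
  proof (rule rotation_equiv_if_coboundary[where h = h'])
    fix x y assume xy: "x \<in> set w" "y \<in> set w" "x \<noteq> y" "x \<otimes> y \<noteq> y \<otimes> x"
    then have "E x y" using generators_commute[OF m, of x y] w by (auto simp: E_def)
    then show "ahead w x y - ahead w' x y = int (h' x) - int (h' y)"
      using h[of x y] h' by (simp add: d_def E_def)
  qed (use w w' in auto)
qed

end

theorem theorem1p1:
  fixes W :: "('a, 'b) monoid_scheme" and S :: "'a set" and c c' :: 'a
  assumes "coxeter_group W S"
    and "finite S"
    and "coxeter_element W S c"
    and "coxeter_element W S c'"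
  shows "conjugate_in W c c' \<longleftrightarrow> rotation_equiv W S c c'"
proof -
  interpret coxeter_group W S by fact
  show ?thesis
  proof
    assume "conjugate_in W c c'"
    with assms(2-4) show "rotation_equiv W S c c'"
      unfolding coxeter_element_def rotation_equiv_def
      using rotation_equiv_if_conjugate by blast
  next
    assume "rotation_equiv W S c c'"
    then show "conjugate_in W c c'"
      unfolding rotation_equiv_def coxeter_word_def
      using conjugate_if_rotation_equiv by blast
  qed
qed

end
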